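(* Let $P$ be a normal fuzzy logic program over a complete lattice $(V,\leqslant)$ and a set of atoms $\Pi$, and let $I\in\mathcal{I}$ be an interpretation. (1) If $(I,I)$ is a fixpoint of $\mathcal{T}_P$, then it is a fixpoint of $\mathcal{U}_P$. (2) If $(I,I)$ is a stable fixpoint of $\mathcal{T}_P$, then it is a stable fixpoint of $\mathcal{U}_P$.
   Context: Setting. $(V,\leqslant)$ is a complete lattice of truth values with least element $0$ and greatest element $1$; $V'\subseteq V$ is a designated subset of truth values allowed as constants and weights; $\Pi$ is a set of atoms. Each $n$-ary connective $f$ has a truth function $f^{\cdot}\colon V^n\to V$. Truth functions of conjunctors, disjunctors and aggregators are monotone in each argument; a conjunctor $\&$ satisfies $x\mathbin{\&^{\cdot}}y\leqslant x$, $x\mathbin{\&^{\cdot}}y\leqslant y$, $x\mathbin{\&^{\cdot}}1=x=1\mathbin{\&^{\cdot}}x$; a disjunctor $|$ satisfies $x\leqslant x\mathbin{|^{\cdot}}y$, $y\leqslant x\mathbin{|^{\cdot}}y$, $x\mathbin{|^{\cdot}}0=x=0\mathbin{|^{\cdot}}x$. Each implicator $\leftarrow_i$ has a truth function that is monotone in the first and antimonotone in the second argument, and is paired with a conjunctor $\wedge_i$ (its adjoint partner: $x\wedge_i^{\cdot}y\leqslant z$ iff $y\leqslant z\leftarrow_i^{\cdot}x$). Default negation $\sim$ has a truth function $\sim^{\cdot}\colon V\to V$ that is an antimonotone involution. Normal fuzzy formulas are built from constants $c\in V'$, atoms $p$ and negated atoms $\sim p$ ($p\in\Pi$) using conjunctors,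 disjunctors and aggregators. A normal fuzzy logic program $P$ is a finite set of rules $p\leftarrow_i^{\vartheta}\mathcal{B}$ with head $p\in\Pi$, weight $\vartheta\in V'$ and body $\mathcal{B}$ a normal fuzzy formula. $\mathcal{I}$ is the complete lattice of interpretations $I\colon\Pi\to V$, ordered pointwise ($\leq$). On pairs, $(x,y)\leq_p(x',y')$ iff $x\leq x'$ and $y'\leq y$. $\hat I(\varphi)$ is the truth-functional evaluation of $\varphi$ under $I$, and $T_P\colon\mathcal{I}\to\mathcal{I}$ is $T_P(I)(p)=\bigvee\{\vartheta\wedge_i^{\cdot}\hat I(\mathcal{B}) : p\leftarrow_i^{\vartheta}\mathcal{B}\in P\}$. Evaluation under a pair $(L,U)\in\mathcal{I}^2$: $\widehat{(L,U)}(c)=c$, $\widehat{(L,U)}(p)=L(p)$, $\widehat{(L,U)}(\sim p)=\sim^{\cdot}U(p)$, and $\widehat{(L,U)}(f(\varphi_1,\dots,\varphi_n))=f^{\cdot}(\widehat{(L,U)}(\varphi_1),\dots,\widehat{(L,U)}(\varphi_n))$. The operator $\mathcal{T}_P\colon\mathcal{I}^2\to\mathcal{I}^2$ is $\mathcal{T}_P(L,U)_1(p)=\bigvee\{\vartheta\wedge_i^{\cdot}\widehat{(L,U)}(\mathcal{B}) : p\leftarrow_i^{\vartheta}\mathcal{B}\in P\}$, $\mathcal{T}_P(L,U)_2=\mathcal{T}_P(U,L)_1$ (subscripts denote components). The ultimate approximator of $T_P$ is $\mathcal{U}_P\colon\mathcal{I}^2\to\mathcal{I}^2$ with $\mathcal{U}_P(x,y)=\left(\bigwedge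 T_P([x,y]),\bigvee T_P([x,y])\right)$, where $T_P([x,y])=\{T_P(z) : x\leq z\leq y\}$ and $\bigwedge,\bigvee$ are glb and lub in $\mathcal{I}$. For a $\leq_p$-monotone operator $\mathcal{A}\colon\mathcal{I}^2\to\mathcal{I}^2$ mapping exact pairs $(x,x)$ to exact pairs, the stable operator is $\mathcal{A}^{\mathit{st}}(x,y)=(\mathit{lfp}(\mathcal{A}(\cdot,y)_1),\mathit{lfp}(\mathcal{A}(x,\cdot)_2))$, where $\mathcal{A}(\cdot,y)_1$ and $\mathcal{A}(x,\cdot)_2$ are the (monotone) operators $z\mapsto\mathcal{A}(z,y)_1$ and $z\mapsto\mathcal{A}(x,z)_2$ on $\mathcal{I}$ and $\mathit{lfp}$ is the least fixpoint in $\mathcal{I}$. A stable fixpoint of $\mathcal{A}$ is a fixpoint of $\mathcal{A}^{\mathit{st}}$. This is applied to both $\mathcal{A}=\mathcal{T}_P$ and $\mathcal{A}=\mathcal{U}_P$.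
   Formalization: In the stable operator the second component, the least fixpoint of A(x,·)_2, is taken among z ≥ x rather than in all of I; with the literal definition part (2) fails, e.g. for P = {p ← 1} over {0,1} and I(p) = 1, where U_P^st(I,I) = (1,0). *)

theory Defs
  imports Main
begin

section \<open>Truth functions\<close>

text \<open>
  The connective symbols form a subset of the type \<open>'c\<close>; symbols outside the four classes below are
  ignored. An \<open>n\<close>-ary truth function takes its arguments as a list, and only its values on lists of
  length \<open>n\<close> matter.
\<close>

record ('c, 'v) fuzzy_structure =
  admissible :: "'v set" \<comment> \<open>the truth values allowed as constants and weights\<close>
  conjunctors :: "'c set"
  disjunctors :: "'c set"
  aggregators :: "'c set"
  implicators :: "'c set"
  arity :: "'c \<Rightarrow> nat"
  truth :: "'c \<Rightarrow> 'v list \<Rightarrow> 'v"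
  partner :: "'c \<Rightarrow> 'c" \<comment> \<open>the conjunctor paired with an implicator\<close>
  neg :: "'v \<Rightarrow> 'v"

definition monotone_in_each :: "nat \<Rightarrow> ('v::order list \<Rightarrow> 'v) \<Rightarrow> bool" where
  "monotone_in_each n F \<longleftrightarrow>
     (\<forall>xs i. length xs = n \<and> i < n \<longrightarrow> mono (\<lambda>x. F (xs[i := x])))"

text \<open>
  \<open>truth S i [z, x]\<close> is the value of the implication with consequent (head) \<open>z\<close> and antecedent (body)
  \<open>x\<close>, the arguments being in the order in which the backward arrow is written.
\<close>

locale fuzzy_logic =
  fixes S :: "('c, 'v::complete_lattice) fuzzy_structure"
  assumes conj_arity: "c \<in> conjunctors S \<Longrightarrow> arity S c = 2"
    and conj_mono: "c \<in> conjunctors S \<Longrightarrow> monotone_in_each 2 (truth S c)"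
    and conj_le1: "c \<in> conjunctors S \<Longrightarrow> truth S c [x, y] \<le> x"
    and conj_le2: "c \<in> conjunctors S \<Longrightarrow> truth S c [x, y] \<le> y"
    and conj_top1: "c \<in> conjunctors S \<Longrightarrow> truth S c [x, top] = x"
    and conj_top2: "c \<in> conjunctors S \<Longrightarrow> truth S c [top, x] = x"
    and disj_arity: "d \<in> disjunctors S \<Longrightarrow> arity S d = 2"
    and disj_mono: "d \<in> disjunctors S \<Longrightarrow> monotone_in_each 2 (truth S d)"
    and disj_ge1: "d \<in> disjunctors S \<Longrightarrow> x \<le> truth S d [x, y]"
    and disj_ge2: "d \<in> disjunctors S \<Longrightarrow> y \<le> truth S d [x, y]"
    and disj_bot1: "d \<in> disjunctors S \<Longrightarrow> truth S d [x, bot] = x"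
    and disj_bot2: "d \<in> disjunctors S \<Longrightarrow> truth S d [bot, x] = x"
    and aggr_mono: "a \<in> aggregators S \<Longrightarrow> monotone_in_each (arity S a) (truth S a)"
    and impl_arity: "i \<in> implicators S \<Longrightarrow> arity S i = 2"
    and impl_mono: "i \<in> implicators S \<Longrightarrow> mono (\<lambda>z. truth S i [z, x])"
    and impl_antimono: "i \<in> implicators S \<Longrightarrow> antimono (\<lambda>x. truth S i [z, x])"
    and partner_conj: "i \<in> implicators S \<Longrightarrow> partner S i \<in> conjunctors S"
    and adjoint: "i \<in> implicators S \<Longrightarrow>
      truth S (partner S i) [x, y] \<le> z \<longleftrightarrow> y \<le> truth S i [z, x]"
    and neg_antimono: "antimono (neg S)"
    and neg_invol: "neg S (neg S x) = x"


section \<open>Normal fuzzy logic programs\<close>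

datatype ('p, 'v, 'c) formula =
    Const 'v
  | Atom 'p
  | NegAtom 'p
  | App 'c "('p, 'v, 'c) formula list"

fun normal_formula :: "('c, 'v) fuzzy_structure \<Rightarrow> ('p, 'v, 'c) formula \<Rightarrow> bool" where
  "normal_formula S (Const c) \<longleftrightarrow> c \<in> admissible S"
| "normal_formula S (Atom p) \<longleftrightarrow> True"
| "normal_formula S (NegAtom p) \<longleftrightarrow> True"
| "normal_formula S (App f \<phi>s) \<longleftrightarrow>
     f \<in> conjunctors S \<union> disjunctors S \<union> aggregators S \<and> length \<phi>s = arity S f \<and>
     (\<forall>\<phi>\<in>set \<phi>s. normal_formula S \<phi>)"

datatype ('p, 'v, 'c) rule =
  Rule (head: 'p) (implicator: 'c) (weight: 'v) (body: "('p, 'v, 'c) formula")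

definition normal_program :: "('c, 'v) fuzzy_structure \<Rightarrow> ('p, 'v, 'c) rule set \<Rightarrow> bool" where
  "normal_program S P \<longleftrightarrow> finite P \<and>
     (\<forall>r\<in>P. implicator r \<in> implicators S \<and> weight r \<in> admissible S \<and> normal_formula S (body r))"

primrec eval :: "('c, 'v) fuzzy_structure \<Rightarrow> ('p \<Rightarrow> 'v) \<Rightarrow> ('p, 'v, 'c) formula \<Rightarrow> 'v" where
  "eval S I (Const c) = c"
| "eval S I (Atom p) = I p"
| "eval S I (NegAtom p) = neg S (I p)"
| "eval S I (App f \<phi>s) = truth S f (map (eval S I) \<phi>s)"

primrec eval_pair ::
    "('c, 'v) fuzzy_structure \<Rightarrow> ('p \<Rightarrow> 'v) \<times> ('p \<Rightarrow> 'v) \<Rightarrow> ('p, 'v, 'c) formula \<Rightarrow> 'v" where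
  "eval_pair S LU (Const c) = c"
| "eval_pair S LU (Atom p) = fst LU p"
| "eval_pair S LU (NegAtom p) = neg S (snd LU p)"
| "eval_pair S LU (App f \<phi>s) = truth S f (map (eval_pair S LU) \<phi>s)"

definition T_op ::
    "('c, 'v::complete_lattice) fuzzy_structure \<Rightarrow> ('p, 'v, 'c) rule set \<Rightarrow> ('p \<Rightarrow> 'v) \<Rightarrow> ('p \<Rightarrow> 'v)"
  where
  "T_op S P I = (\<lambda>p. Sup {truth S (partner S (implicator r)) [weight r, eval S I (body r)] | r.
     r \<in> P \<and> head r = p})"

definition T_pair_lower ::
    "('c, 'v::complete_lattice) fuzzy_structure \<Rightarrow> ('p, 'v, 'c) rule set \<Rightarrow>
     ('p \<Rightarrow> 'v) \<times> ('p \<Rightarrow> 'v) \<Rightarrow> ('p \<Rightarrow> 'v)" where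
  "T_pair_lower S P LU =
     (\<lambda>p. Sup {truth S (partner S (implicator r)) [weight r, eval_pair S LU (body r)] | r.
        r \<in> P \<and> head r = p})"

definition T_pair ::
    "('c, 'v::complete_lattice) fuzzy_structure \<Rightarrow> ('p, 'v, 'c) rule set \<Rightarrow>
     ('p \<Rightarrow> 'v) \<times> ('p \<Rightarrow> 'v) \<Rightarrow> ('p \<Rightarrow> 'v) \<times> ('p \<Rightarrow> 'v)" where
  "T_pair S P = (\<lambda>(L, U). (T_pair_lower S P (L, U), T_pair_lower S P (U, L)))"


section \<open>Ultimate approximator and stable operator\<close>

definition ultimate :: "('l::complete_lattice \<Rightarrow> 'l) \<Rightarrow> 'l \<times> 'l \<Rightarrow> 'l \<times> 'l" where
  "ultimate f = (\<lambda>(x, y). (Inf (f ` {x..y}), Sup (f ` {x..y})))"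

text \<open>
  The least fixpoint of \<open>\<lambda>z. snd (A (x, z))\<close> is taken in \<open>{x..}\<close>, as is usual for
  approximators that carry information only on consistent pairs (Denecker, Marek and Truszczynski,
  Ultimate approximation and its application in nonmonotonic knowledge representation systems,
  2004). Over the whole lattice it would be \<open>bot\<close> for every ultimate approximator as soon as \<open>x\<close> is
  not \<open>bot\<close>, because \<open>{x..bot}\<close> is then empty; see \<open>lfp_ultimate_snd\<close>. For exact pairs and
  \<open>T_pair\<close> the two readings agree; see \<open>stable_op_T_pair_iff_lfp\<close>.
\<close>

definition stable_op :: "('l::complete_lattice \<times> 'l \<Rightarrow> 'l \<times> 'l) \<Rightarrow> 'l \<times> 'l \<Rightarrow> 'l \<times> 'l" where
  "stable_op A = (\<lambda>(x, y).
     (lfp (\<lambda>z. fst (A (z, y))), LEAST z. x \<le> z \<and> snd (A (x, z)) = z))"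

lemma lfp_ultimate_snd:
  assumes "x \<noteq> bot"
  shows "lfp (\<lambda>z. snd (ultimate f (x, z))) = bot"
proof -
  have "{x..bot} = {}"
    using assms by (auto simp: bot_unique dest: order_trans)
  then have "snd (ultimate f (x, bot)) \<le> bot"
    by (simp add: ultimate_def)
  then show ?thesis
    using lfp_lowerbound[of "\<lambda>z. snd (ultimate f (x, z))" bot] by (simp add: bot_unique)
qed

lemma monotone_in_eachD:
  assumes "monotone_in_each n F" "list_all2 (\<le>) xs ys" "length xs = n"
  shows "F xs \<le> F ys"
proof -
  have "F (ps @ xs) \<le> F (ps @ ys)" if "length ps + length xs = n" for ps
    using assms(2) that
  proof (induction arbitrary: ps rule: list_all2_induct)
    case (Cons x xs y ys)
    have "mono (\<lambda>z. F ((ps @ x # xs)[length ps := z]))"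
      by (rule assms(1)[unfolded monotone_in_each_def, rule_format]) (use Cons.prems in simp)
    then have "F (ps @ x # xs) \<le> F (ps @ y # xs)"
      using Cons.hyps(1) by (simp add: mono_def)
    also have "\<dots> \<le> F (ps @ y # ys)"
      using Cons.IH[of "ps @ [y]"] Cons.prems by simp
    finally show ?case .
  qed simp
  from this[of "[]"] show ?thesis
    using assms(3) by simp
qed

context fuzzy_logic
begin

lemma eval_pair_mono:
  assumes "normal_formula S \<phi>" "fst LU \<le> fst LU'" "snd LU' \<le> snd LU"
  shows "eval_pair S LU \<phi> \<le> eval_pair S LU' \<phi>"
  using assms(1)
proof (induction \<phi>)
  case (App f \<phi>s)
  have "monotone_in_each (arity S f) (truth S f)"
    using App.prems conj_arity[of f] conj_mono[of f] disj_arity[of f] disj_mono[of f] aggr_mono[of f]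
    by auto
  moreover have "list_all2 (\<le>) (map (eval_pair S LU) \<phi>s) (map (eval_pair S LU') \<phi>s)"
    using App by (auto simp: list_all2_conv_all_nth list_all_iff)
  ultimately show ?case
    using App.prems by (auto intro: monotone_in_eachD)
qed (use assms(2,3) neg_antimono in \<open>auto simp: le_fun_def antimono_def\<close>)

lemma T_pair_lower_mono:
  assumes "normal_program S P" "fst LU \<le> fst LU'" "snd LU' \<le> snd LU"
  shows "T_pair_lower S P LU \<le> T_pair_lower S P LU'"
proof (rule le_funI)
  fix p
  have *: "truth S (partner S (implicator r)) [weight r, eval_pair S LU (body r)]
      \<le> truth S (partner S (implicator r)) [weight r, eval_pair S LU' (body r)]"
    if "r \<in> P" for r
    by (rule monotone_in_eachD[OF conj_mono])
      (use that assms in \<open>auto simp: normal_program_def intro: partner_conj eval_pair_mono\<close>)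
  show "T_pair_lower S P LU p \<le> T_pair_lower S P LU' p"
    unfolding T_pair_lower_def by (rule Sup_mono) (use * in blast)
qed

lemma stable_op_T_pair_iff_lfp:
  assumes "normal_program S P"
  shows "stable_op (T_pair S P) (I, I) = (I, I) \<longleftrightarrow>
    (lfp (\<lambda>z. fst (T_pair S P (z, I))), lfp (\<lambda>z. snd (T_pair S P (I, z)))) = (I, I)"
proof -
  have eq: "(\<lambda>z. snd (T_pair S P (I, z))) = (\<lambda>z. fst (T_pair S P (z, I)))"
    by (simp add: T_pair_def)
  have "mono (\<lambda>z. fst (T_pair S P (z, I)))"
    by (auto simp: mono_def T_pair_def intro!: T_pair_lower_mono[OF assms])
  then have "fst (T_pair S P (I, I)) = I" if "lfp (\<lambda>z. fst (T_pair S P (z, I))) = I"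
    using lfp_unfold[of "\<lambda>z. fst (T_pair S P (z, I))"] that by simp
  then have "(LEAST z. I \<le> z \<and> snd (T_pair S P (I, z)) = z) = I"
    if "lfp (\<lambda>z. fst (T_pair S P (z, I))) = I"
    using that fun_cong[OF eq, of I] by (intro Least_equality) auto
  then show ?thesis
    unfolding eq by (auto simp: stable_op_def)
qed

end

end

theory Submission
  imports Defs
begin

text \<open>
  The operator \<open>T_pair\<close> extends \<open>T_op\<close> on exact pairs and is monotone in the precision order, so it
  lies below \<open>ultimate (T_op S P)\<close> there. Hence the least fixpoint of the lower
  revision can only grow when passing to the ultimate approximator, while the fixpoint \<open>I\<close> itself
  bounds it from above.
\<close>

lemma eval_pair_exact: "eval_pair S (I, I) \<phi> = eval S I \<phi>"
  by (induction \<phi>) (simp_all cong: map_cong)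

lemma T_pair_lower_exact: "T_pair_lower S P (I, I) = T_op S P I"
  by (simp add: T_pair_lower_def T_op_def eval_pair_exact)

lemma T_pair_exact: "T_pair S P (I, I) = (T_op S P I, T_op S P I)"
  by (simp add: T_pair_def T_pair_lower_exact)

lemma ultimate_exact: "ultimate f (x, x) = (f x, f x)"
  by (simp add: ultimate_def)

text \<open>Every \<open>z\<close> in \<open>{x..y}\<close> makes \<open>(z, z)\<close> more precise
  than \<open>(x, y)\<close>, so the left side bounds each member of the infimum. If
  \<open>x \<le> y\<close> fails, the infimum is over the empty set and equals
  \<open>top\<close>.\<close>

lemma (in fuzzy_logic) T_pair_le_ultimate:
  assumes "normal_program S P"
  shows "fst (T_pair S P (x, y)) \<le> fst (ultimate (T_op S P) (x, y))"
proof -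
  have "T_pair_lower S P (x, y) \<le> T_op S P z" if "z \<in> {x..y}" for z
    using T_pair_lower_mono[OF assms, of "(x, y)" "(z, z)"] that by (simp add: T_pair_lower_exact)
  then show ?thesis
    by (auto simp: T_pair_def ultimate_def intro: INF_greatest)
qed

lemma stable_op_ultimate_exact:
  assumes fixpoint: "f x = x"
    and lower: "x \<le> lfp (\<lambda>z. fst (ultimate f (z, x)))"
  shows "stable_op (ultimate f) (x, x) = (x, x)"
proof -
  have "lfp (\<lambda>z. fst (ultimate f (z, x))) \<le> x"
    by (rule lfp_lowerbound) (simp add: ultimate_exact fixpoint)
  \<comment> \<open>The search runs over \<open>{x..}\<close>, whose least element \<open>x\<close>
    is itself fixed.\<close>
  moreover have "(LEAST z. x \<le> z \<and> snd (ultimate f (x, z)) = z) = x"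
    by (rule Least_equality) (simp_all add: ultimate_exact fixpoint)
  ultimately show ?thesis
    using lower by (simp add: stable_op_def)
qed

text \<open>Unfolding the least fixpoint once evaluates \<open>T_pair\<close> at the exact pair
  \<open>(I, I)\<close>, where it agrees with \<open>T_op\<close>.\<close>

lemma (in fuzzy_logic) stable_T_pair_fixpoint:
  assumes "normal_program S P" and stable: "lfp (\<lambda>z. fst (T_pair S P (z, I))) = I"
  shows "T_op S P I = I"
proof -
  have "mono (\<lambda>z. fst (T_pair S P (z, I)))"
    by (auto simp: mono_def T_pair_def intro!: T_pair_lower_mono[OF assms(1)])
  from lfp_unfold[OF this] show ?thesis
    by (simp add: stable T_pair_exact)
qed

theorem proposition14:
  fixes S :: "('c, 'v::complete_lattice) fuzzy_structure"
    and P :: "('p, 'v, 'c) rule set"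
    and I :: "'p \<Rightarrow> 'v"
  assumes "fuzzy_logic S"
    and "normal_program S P"
  shows "(T_pair S P (I, I) = (I, I) \<longrightarrow> ultimate (T_op S P) (I, I) = (I, I)) \<and>
    (stable_op (T_pair S P) (I, I) = (I, I) \<longrightarrow> stable_op (ultimate (T_op S P)) (I, I) = (I, I))"
proof (intro conjI impI)
  assume "T_pair S P (I, I) = (I, I)"
  then show "ultimate (T_op S P) (I, I) = (I, I)"
    by (simp add: T_pair_exact ultimate_exact)
next
  interpret fuzzy_logic S by fact
  assume "stable_op (T_pair S P) (I, I) = (I, I)"
  then have stable: "lfp (\<lambda>z. fst (T_pair S P (z, I))) = I"
    by (simp add: stable_op_def)
  have "lfp (\<lambda>z. fst (T_pair S P (z, I))) \<le> lfp (\<lambda>z. fst (ultimate (T_op S P) (z, I)))"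
    \<comment> \<open>The comparison must hold at every \<open>z\<close>, including those not below
      \<open>I\<close>, where the ultimate lower bound is \<open>top\<close>.\<close>
    by (rule lfp_mono) (rule T_pair_le_ultimate[OF assms(2)])
  then show "stable_op (ultimate (T_op S P)) (I, I) = (I, I)"
    using stable_T_pair_fixpoint[OF assms(2) stable] stable
    by (intro stable_op_ultimate_exact) simp_all
qed

end
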